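(* Let $\mathbf A=\{a_{ij}\}_{i,j=1}^n$ be a real $n\times n$ matrix with $a_{ii}<0$ for all $i=1,\dots,n$, let $b<0$, and let $$\mathbf C=\begin{pmatrix}\mathbf A & b\mathbf I\\ \mathbf I & \mathbf O\end{pmatrix}$$ be the corresponding $2n\times 2n$ matrix ($\mathbf I$ is the $n\times n$ identity, $\mathbf O$ the $n\times n$ zero matrix). Then $\mathbf C$ is $(\mathcal G_1,\diamond)$-stable if and only if $\mathbf A$ is $D$-stable.
   Context: A real square matrix is stable if all its eigenvalues have negative real parts. A positive diagonal matrix is a diagonal matrix with all diagonal entries positive. A real $n\times n$ matrix $\mathbf A$ is $D$-stable if $\mathbf D\mathbf A$ is stable for every positive diagonal $n\times n$ matrix $\mathbf D$. For real $2n\times 2n$ matrices partitioned into $n\times n$ blocks, $\mathbf H=(\mathbf H_{ij})_{i,j=1,2}$ and $\mathbf G=(\mathbf G_{ij})_{i,j=1,2}$, the block Hadamard product $\mathbf H\diamond\mathbf G$ is the matrix with blocks $\mathbf H_{ij}\mathbf G_{ij}$ (usual matrix products of blocks). $\mathcal G_1$ is the set of all $2n\times 2n$ matrices $\begin{pmatrix}\mathbf D&\mathbf I\\ \mathbf I&\mathbf I\end{pmatrix}$ with $\mathbf D$ an $n\times n$ positive diagonal matrix. A matrix $\mathbf C$ is $(\mathcal G_1,\diamond)$-stable if both $\mathbf G\diamond\mathbf C$ and $\mathbf C\diamond\mathbf G$ are stable for every $\mathbf G\in\mathcal G_1$. *)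

theory Defs
  imports "Jordan_Normal_Form.Char_Poly"
begin

(* "All eigenvalues" refers to the complex spectrum, so the real matrix is mapped to complex. *)
definition stable :: "real mat \<Rightarrow> bool" where
  "stable A \<longleftrightarrow> square_mat A \<and>
     (\<forall>z. eigenvalue (map_mat complex_of_real A) z \<longrightarrow> Re z < 0)"

definition positive_diagonal :: "nat \<Rightarrow> real mat set" where
  "positive_diagonal n =
     {D \<in> carrier_mat n n. diagonal_mat D \<and> (\<forall>i<n. D $$ (i, i) > 0)}"

definition D_stable :: "nat \<Rightarrow> real mat \<Rightarrow> bool" where
  "D_stable n A \<longleftrightarrow> A \<in> carrier_mat n n \<and> (\<forall>D \<in> positive_diagonal n. stable (D * A))"

(* Meaningful for 2n x 2n arguments, each partitioned into four n x n blocks. *)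
definition block_hadamard :: "nat \<Rightarrow> real mat \<Rightarrow> real mat \<Rightarrow> real mat" where
  "block_hadamard n H G =
     (case (split_block H n n, split_block G n n) of
        ((H11, H12, H21, H22), (G11, G12, G21, G22)) \<Rightarrow>
          four_block_mat (H11 * G11) (H12 * G12) (H21 * G21) (H22 * G22))"

definition block_hadamard_stable :: "nat \<Rightarrow> real mat set \<Rightarrow> real mat \<Rightarrow> bool" where
  "block_hadamard_stable n \<G> C \<longleftrightarrow> C \<in> carrier_mat (2 * n) (2 * n) \<and>
     (\<forall>G \<in> \<G>. stable (block_hadamard n G C) \<and> stable (block_hadamard n C G))"

definition \<G>\<^sub>1 :: "nat \<Rightarrow> real mat set" where
  "\<G>\<^sub>1 n = {four_block_mat D (1\<^sub>m n) (1\<^sub>m n) (1\<^sub>m n) | D. D \<in> positive_diagonal n}"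

end

theory Submission
  imports Defs
begin

text \<open>
  If \<open>(x, y)\<close> is an eigenvector of \<open>((M, b I), (I, 0))\<close> for \<open>z\<close>, then \<open>x = z y\<close> and
  \<open>M y = (z - b / z) y\<close>. For real \<open>b < 0\<close> the map \<open>z \<mapsto> z - b / z\<close> preserves the sign of the real
  part and is surjective onto the complex numbers, so the block matrix is stable iff \<open>M\<close> is. Both
  block products with \<open>C\<close> have this shape, with \<open>M = D A\<close> and \<open>M = A D\<close> respectively, and
  \<open>A D\<close> is similar to \<open>D A\<close>.
\<close>

text \<open>The general field allows use on complexified matrices. The conjunct
  \<open>z \<noteq> 0\<close> matters: since \<open>b / 0 = 0\<close>, at \<open>z = 0\<close> the
  other conjunct reads \<open>eigenvalue M 0\<close>, which may hold although 0 is never an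
  eigenvalue of the block matrix when \<open>b \<noteq> 0\<close>.\<close>

lemma eigenvalue_companion_block:
  fixes M :: "'a :: field mat"
  assumes M: "M \<in> carrier_mat n n" and b: "b \<noteq> 0"
  shows "eigenvalue (four_block_mat M (b \<cdot>\<^sub>m 1\<^sub>m n) (1\<^sub>m n) (0\<^sub>m n n)) z
           \<longleftrightarrow> z \<noteq> 0 \<and> eigenvalue M (z - b / z)"
    (is "eigenvalue ?C z \<longleftrightarrow> _")
proof -
  have mult: "?C *\<^sub>v (x @\<^sub>v y) = (M *\<^sub>v x + b \<cdot>\<^sub>v y) @\<^sub>v x"
    if x: "x \<in> carrier_vec n" and y: "y \<in> carrier_vec n" for x y
  proof -
    have "?C *\<^sub>v (x @\<^sub>v y) =
        (M *\<^sub>v x + (b \<cdot>\<^sub>m 1\<^sub>m n) *\<^sub>v y) @\<^sub>v (1\<^sub>m n *\<^sub>v x + 0\<^sub>m n n *\<^sub>v y)"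
      by (rule four_block_mat_mult_vec[OF M _ _ _ x y]) auto
    moreover have "(b \<cdot>\<^sub>m 1\<^sub>m n) *\<^sub>v y = b \<cdot>\<^sub>v y"
      using y by (intro eq_vecI) auto
    moreover have "0\<^sub>m n n *\<^sub>v y = 0\<^sub>v n"
      using y by (intro eq_vecI) auto
    ultimately show ?thesis using x y by simp
  qed
  have eq: "?C *\<^sub>v (x @\<^sub>v y) = z \<cdot>\<^sub>v (x @\<^sub>v y) \<longleftrightarrow> M *\<^sub>v x + b \<cdot>\<^sub>v y = z \<cdot>\<^sub>v x \<and> x = z \<cdot>\<^sub>v y"
    if x: "x \<in> carrier_vec n" and y: "y \<in> carrier_vec n" for x y
  proof -
    have "z \<cdot>\<^sub>v (x @\<^sub>v y) = z \<cdot>\<^sub>v x @\<^sub>v z \<cdot>\<^sub>v y"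
      using x y by (intro eq_vecI) auto
    then show ?thesis
      unfolding mult[OF x y] using x y M by (subst append_vec_eq[of _ n, symmetric]) auto
  qed
  show ?thesis
  proof
    assume "eigenvalue ?C z"
    then obtain v where v: "v \<in> carrier_vec (n + n)" "v \<noteq> 0\<^sub>v (n + n)" "?C *\<^sub>v v = z \<cdot>\<^sub>v v"
      using M unfolding eigenvalue_def eigenvector_def by auto
    define x y where "x = vec_first v n" and "y = vec_last v n"
    have x: "x \<in> carrier_vec n" and y: "y \<in> carrier_vec n" and vxy: "v = x @\<^sub>v y"
      using v(1) unfolding x_def y_def by auto
    have Mx: "M *\<^sub>v x + b \<cdot>\<^sub>v y = z \<cdot>\<^sub>v x" and xz: "x = z \<cdot>\<^sub>v y"
      using v(3) eq[OF x y] vxy by auto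
    have ynz: "y \<noteq> 0\<^sub>v n"
    proof
      assume "y = 0\<^sub>v n"
      then have "v = 0\<^sub>v (n + n)" unfolding vxy xz by (intro eq_vecI) auto
      with v(2) show False by simp
    qed
    \<comment> \<open>The upper block row with \<open>x\<close> replaced by \<open>z\<close> times
      \<open>y\<close>, not yet divided by \<open>z\<close>. At \<open>z = 0\<close> it would force
      \<open>b * y $ i = 0\<close>, which rules that case out; afterwards division is
      allowed.\<close>
    have entry: "z * (M *\<^sub>v y) $ i + b * y $ i = z * (z * y $ i)" if "i < n" for i
    proof -
      have "z \<cdot>\<^sub>v (M *\<^sub>v y) + b \<cdot>\<^sub>v y = z \<cdot>\<^sub>v (z \<cdot>\<^sub>v y)"
        using Mx mult_mat_vec[OF M y] unfolding xz by simp
      from arg_cong[OF this, of "\<lambda>w. w $ i"] show ?thesis using that M y by simp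
    qed
    have z: "z \<noteq> 0"
    proof
      assume "z = 0"
      with entry b have "y = 0\<^sub>v n" using y by (intro eq_vecI) auto
      with ynz show False ..
    qed
    have "M *\<^sub>v y = (z - b / z) \<cdot>\<^sub>v y"
    proof (rule eq_vecI)
      fix i assume "i < dim_vec ((z - b / z) \<cdot>\<^sub>v y)"
      then show "(M *\<^sub>v y) $ i = ((z - b / z) \<cdot>\<^sub>v y) $ i"
        using entry[of i] y z by (simp add: field_simps)
    qed (use M y in auto)
    with z y ynz M show "z \<noteq> 0 \<and> eigenvalue M (z - b / z)"
      unfolding eigenvalue_def eigenvector_def by auto
  next
    assume "z \<noteq> 0 \<and> eigenvalue M (z - b / z)"
    then obtain y where z: "z \<noteq> 0" and y: "y \<in> carrier_vec n" and ynz: "y \<noteq> 0\<^sub>v n"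
      and My: "M *\<^sub>v y = (z - b / z) \<cdot>\<^sub>v y"
      using M unfolding eigenvalue_def eigenvector_def by auto
    define x where "x = z \<cdot>\<^sub>v y"
    have x: "x \<in> carrier_vec n" using y unfolding x_def by auto
    have "M *\<^sub>v x + b \<cdot>\<^sub>v y = z \<cdot>\<^sub>v x"
      unfolding x_def mult_mat_vec[OF M y] My using y z
      by (intro eq_vecI) (auto simp: field_simps)
    then have "?C *\<^sub>v (x @\<^sub>v y) = z \<cdot>\<^sub>v (x @\<^sub>v y)"
      using eq[OF x y] x_def by simp
    moreover have "x @\<^sub>v y \<noteq> 0\<^sub>v (n + n)"
    proof
      assume "x @\<^sub>v y = 0\<^sub>v (n + n)"
      also have "\<dots> = 0\<^sub>v n @\<^sub>v 0\<^sub>v n" by (intro eq_vecI) auto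
      finally have "y = 0\<^sub>v n" using append_vec_eq[OF x, of "0\<^sub>v n"] by simp
      with ynz show False ..
    qed
    ultimately show "eigenvalue ?C z"
      unfolding eigenvalue_def eigenvector_def using x y M
      by (intro exI[of _ "x @\<^sub>v y"]) auto
  qed
qed

text \<open>Holds because 1/z is the conjugate of z divided by its squared modulus. For
  \<open>b < 0\<close> and \<open>z \<noteq> 0\<close> the second factor is positive, so the sign of
  \<open>Re z\<close> is kept.\<close>

lemma Re_diff_divide:
  "Re (z - of_real b / z) = Re z * (1 - b / (cmod z)\<^sup>2)"
  by (simp add: Re_divide cmod_power2 algebra_simps)

lemma complex_quadratic_root:
  obtains z :: complex where "z\<^sup>2 = u * z + v"
proof
  show "((u + csqrt (u\<^sup>2 + 4 * v)) / 2)\<^sup>2 = u * ((u + csqrt (u\<^sup>2 + 4 * v)) / 2) + v"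
    using power2_csqrt[of "u\<^sup>2 + 4 * v"] by (simp add: power2_eq_square field_simps)
qed

lemma stable_companion_block_iff:
  assumes M: "M \<in> carrier_mat n n" and b: "b < 0"
  shows "stable (four_block_mat M (b \<cdot>\<^sub>m 1\<^sub>m n) (1\<^sub>m n) (0\<^sub>m n n)) \<longleftrightarrow> stable M"
    (is "stable ?C \<longleftrightarrow> _")
proof -
  let ?c = "map_mat complex_of_real"
  have "?c ?C = four_block_mat (?c M) (of_real b \<cdot>\<^sub>m 1\<^sub>m n) (1\<^sub>m n) (0\<^sub>m n n)"
    using M by (intro eq_matI) auto
  then have ev: "eigenvalue (?c ?C) z \<longleftrightarrow> z \<noteq> 0 \<and> eigenvalue (?c M) (z - of_real b / z)" for z
    using eigenvalue_companion_block[of "?c M" n "of_real b" z] M b by simp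
  have sgn: "Re (z - of_real b / z) < 0 \<longleftrightarrow> Re z < 0" if "z \<noteq> 0" for z
  proof -
    have "1 - b / (cmod z)\<^sup>2 > 0"
      using b that by (smt (verit) divide_neg_pos zero_less_norm_iff zero_less_power)
    then show ?thesis unfolding Re_diff_divide by (simp add: mult_less_0_iff)
  qed
  \<comment> \<open>Needed to pass from stability of the block matrix to that of \<open>M\<close>:
    each eigenvalue \<open>w\<close> of \<open>M\<close> must come from some eigenvalue
    \<open>z\<close> of the block matrix. Clearing the denominator gives a quadratic in
    \<open>z\<close>, whose constant term \<open>b\<close> excludes the root 0.\<close>
  have surj: "\<exists>z. z \<noteq> 0 \<and> z - of_real b / z = w" for w :: complex
  proof -
    obtain z where z: "z\<^sup>2 = w * z + of_real b" using complex_quadratic_root[of w "of_real b"] by blast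
    with b have "z \<noteq> 0" by auto
    moreover from this z have "z - of_real b / z = w"
      by (simp add: field_simps power2_eq_square)
    ultimately show ?thesis by blast
  qed
  have "(\<forall>z. eigenvalue (?c ?C) z \<longrightarrow> Re z < 0) \<longleftrightarrow> (\<forall>w. eigenvalue (?c M) w \<longrightarrow> Re w < 0)"
    using ev sgn surj by metis
  moreover have "square_mat ?C" "square_mat M" using M by auto
  ultimately show ?thesis unfolding stable_def by blast
qed

text \<open>\<open>D\<close> carries an eigenvector of \<open>A * D\<close> to one of
  \<open>D * A\<close> for the same eigenvalue. One implication suffices, since D-stability already
  speaks of \<open>D * A\<close>.\<close>

lemma stable_mult_positive_diagonal_commute:
  assumes A: "A \<in> carrier_mat n n" and D: "D \<in> positive_diagonal n" and st: "stable (D * A)"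
  shows "stable (A * D)"
proof -
  let ?c = "map_mat complex_of_real"
  have Dc: "D \<in> carrier_mat n n" and diag: "diagonal_mat D" and pos: "\<And>i. i < n \<Longrightarrow> D $$ (i, i) > 0"
    using D unfolding positive_diagonal_def by auto
  have cA: "?c A \<in> carrier_mat n n" and cD: "?c D \<in> carrier_mat n n" using A Dc by auto
  have hom: "?c (A * D) = ?c A * ?c D" "?c (D * A) = ?c D * ?c A"
    using of_real_hom.mat_hom_mult[OF A Dc] of_real_hom.mat_hom_mult[OF Dc A] by auto
  \<comment> \<open>This entrywise action, with positive diagonal entries, makes \<open>D\<close>
    injective, so the image of an eigenvector is nonzero.\<close>
  have Dy: "(?c D *\<^sub>v y) $ i = of_real (D $$ (i, i)) * y $ i"
    if y: "y \<in> carrier_vec n" and i: "i < n" for y i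
  proof -
    have "(?c D *\<^sub>v y) $ i = (\<Sum>j = 0..<n. of_real (D $$ (i, j)) * y $ j)"
      using y i Dc by (simp add: scalar_prod_def)
    also have "\<dots> = (\<Sum>j = 0..<n. if j = i then of_real (D $$ (i, i)) * y $ i else 0)"
      using diag i Dc by (intro sum.cong) (auto simp: diagonal_mat_def)
    finally show ?thesis using i by simp
  qed
  have "eigenvalue (?c (D * A)) z" if ev: "eigenvalue (?c (A * D)) z" for z
  proof -
    obtain y where y: "y \<in> carrier_vec n" and ynz: "y \<noteq> 0\<^sub>v n"
      and ADy: "(?c A * ?c D) *\<^sub>v y = z \<cdot>\<^sub>v y"
      using ev A unfolding hom eigenvalue_def eigenvector_def by auto
    have w: "?c D *\<^sub>v y \<in> carrier_vec n" using cD y by auto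
    have "(?c D * ?c A) *\<^sub>v (?c D *\<^sub>v y) = ?c D *\<^sub>v ((?c A * ?c D) *\<^sub>v y)"
      using assoc_mult_mat_vec[OF cD cA w] assoc_mult_mat_vec[OF cA cD y] by simp
    also have "\<dots> = z \<cdot>\<^sub>v (?c D *\<^sub>v y)"
      unfolding ADy by (rule mult_mat_vec[OF cD y])
    finally have "(?c D * ?c A) *\<^sub>v (?c D *\<^sub>v y) = z \<cdot>\<^sub>v (?c D *\<^sub>v y)" .
    moreover have "?c D *\<^sub>v y \<noteq> 0\<^sub>v n"
    proof
      assume zero: "?c D *\<^sub>v y = 0\<^sub>v n"
      have "y $ i = 0" if "i < n" for i
        using Dy[OF y that] pos[OF that] that unfolding zero by simp
      with y have "y = 0\<^sub>v n" by (intro eq_vecI) auto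
      with ynz show False ..
    qed
    ultimately show ?thesis
      unfolding hom eigenvalue_def eigenvector_def using w Dc by auto
  qed
  with st A Dc show ?thesis unfolding stable_def by auto
qed

lemma block_hadamard_four_block_mat:
  assumes "H11 \<in> carrier_mat n n" "H12 \<in> carrier_mat n n"
    "H21 \<in> carrier_mat n n" "H22 \<in> carrier_mat n n"
    "G11 \<in> carrier_mat n n" "G12 \<in> carrier_mat n n"
    "G21 \<in> carrier_mat n n" "G22 \<in> carrier_mat n n"
  shows "block_hadamard n (four_block_mat H11 H12 H21 H22) (four_block_mat G11 G12 G21 G22) =
    four_block_mat (H11 * G11) (H12 * G12) (H21 * G21) (H22 * G22)"
proof -
  have "split_block (four_block_mat P Q R S) n n = (P, Q, R, S)"
    if "P \<in> carrier_mat n n" "Q \<in> carrier_mat n n" "R \<in> carrier_mat n n" "S \<in> carrier_mat n n"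
    for P Q R S :: "real mat"
    using that unfolding split_block_def Let_def by (auto intro!: eq_matI)
  with assms show ?thesis unfolding block_hadamard_def by simp
qed

theorem theorem2:
  fixes n :: nat and A :: "real mat" and b :: real
  assumes "A \<in> carrier_mat n n"
    and "\<forall>i<n. A $$ (i, i) < 0"
    and "b < 0"
  shows "block_hadamard_stable n (\<G>\<^sub>1 n) (four_block_mat A (b \<cdot>\<^sub>m 1\<^sub>m n) (1\<^sub>m n) (0\<^sub>m n n))
           \<longleftrightarrow> D_stable n A"
proof -
  note A = assms(1)
  let ?C = "four_block_mat A (b \<cdot>\<^sub>m 1\<^sub>m n) (1\<^sub>m n) (0\<^sub>m n n)"
  let ?G = "\<lambda>D. four_block_mat D (1\<^sub>m n) (1\<^sub>m n) (1\<^sub>m n)"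
  \<comment> \<open>The three identity blocks of \<open>?G D\<close> leave the other blocks of
    \<open>?C\<close> unchanged; only the upper left corner becomes \<open>D * A\<close> or
    \<open>A * D\<close>, so the companion block criterion applies.\<close>
  have GC: "stable (block_hadamard n (?G D) ?C) \<longleftrightarrow> stable (D * A)"
    and CG: "stable (block_hadamard n ?C (?G D)) \<longleftrightarrow> stable (A * D)"
    if "D \<in> positive_diagonal n" for D
  proof -
    have D: "D \<in> carrier_mat n n" using that unfolding positive_diagonal_def by simp
    show "stable (block_hadamard n (?G D) ?C) \<longleftrightarrow> stable (D * A)"
      using A D stable_companion_block_iff[of "D * A" n b] assms(3)
      by (simp add: block_hadamard_four_block_mat)
    show "stable (block_hadamard n ?C (?G D)) \<longleftrightarrow> stable (A * D)"
      using A D stable_companion_block_iff[of "A * D" n b] assms(3)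
      by (simp add: block_hadamard_four_block_mat)
  qed
  have "?C \<in> carrier_mat (2 * n) (2 * n)" using A by (auto simp: mult_2)
  \<comment> \<open>\<open>GC\<close> alone gives D-stability of \<open>A\<close>; conversely,
    \<open>CG\<close> also needs the passage from \<open>D * A\<close> to
    \<open>A * D\<close>.\<close>
  then show ?thesis
    unfolding block_hadamard_stable_def D_stable_def \<G>\<^sub>1_def
    using A GC CG stable_mult_positive_diagonal_commute[OF A] by blast
qed

end
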